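(* Let $(X,f)$ be a topological dynamical system and let $x\in X$ be a point. If $x$ is $\mathcal{F}_{ps}$-product recurrent ($\mathcal{F}_{ps}$-PR), then $x$ is distal.
   Context: $\mathbb{N}$ is the set of positive integers. A topological dynamical system is a pair $(X,f)$ where $(X,d)$ is a compact metric space and $f\colon X\to X$ is continuous. For $x\in X$, $A\subset X$: $N_f(x,A)=\{n\in\mathbb{N}: f^n(x)\in A\}$, and the (positive) orbit of $x$ is $\{f^n(x): n\in\mathbb{N}\}$; its closure is the orbit closure of $x$. A point $x$ is recurrent if $N_f(x,U)\neq\emptyset$ for every open $U\ni x$. A set $F\subset\mathbb{N}$ is thick if for every $n>0$ there is $i\in\mathbb{N}$ with $\{i,i+1,\dots,i+n\}\subset F$; syndetic if there is $N\in\mathbb{N}$ with $[i,i+N]\cap F\neq\emptyset$ for each $i\in\mathbb{N}$; piecewise syndetic if it is the intersection of a thick set and a syndetic set. $\mathcal{F}_{ps}$ is the family of all piecewise syndetic sets. A point $y$ of a system $(Y,g)$ is $\mathcal{F}_{ps}$-recurrent if $N_g(y,V)\in\mathcal{F}_{ps}$ for every open neighborhood $V$ of $y$. A recurrent point $x$ of $(X,f)$ is $\mathcal{F}_{ps}$-product recurrent ($\mathcal{F}_{ps}$-PR) if for every $\mathcal{F}_{ps}$-recurrent point $y$ in any topological dynamical system $(Y,g)$, the pair $(x,y)$ is recurrent for $(X\times Y,f\times g)$. Points $x,y\in X$ are proximal if there is an increasing sequence $\{n_k\}_{k=1}^\infty\subset\mathbb{N}$ with $\lim_{k\to\infty}d(f^{n_k}(x),f^{n_k}(y))=0$.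 A point is distal if it is not proximal to any point in its orbit closure other than itself. *)

theory Defs
  imports "HOL-Analysis.Analysis"
begin

text \<open>
  Times are positive integers throughout: sets of times are sets of positive naturals, and
  hitting sets and orbits start at time 1.
\<close>

definition thick :: "nat set \<Rightarrow> bool" where
  "thick F \<longleftrightarrow> F \<subseteq> {1..} \<and> (\<forall>n>0. \<exists>i\<ge>1. {i..i + n} \<subseteq> F)"

definition syndetic :: "nat set \<Rightarrow> bool" where
  "syndetic F \<longleftrightarrow> F \<subseteq> {1..} \<and> (\<exists>N\<ge>1. \<forall>i\<ge>1. {i..i + N} \<inter> F \<noteq> {})"

definition piecewise_syndetic :: "nat set \<Rightarrow> bool" where
  "piecewise_syndetic F \<longleftrightarrow> (\<exists>T S. thick T \<and> syndetic S \<and> F = T \<inter> S)"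

definition hitting_times :: "('a \<Rightarrow> 'a) \<Rightarrow> 'a \<Rightarrow> 'a set \<Rightarrow> nat set" where
  "hitting_times f x A = {n. n \<ge> 1 \<and> (f ^^ n) x \<in> A}"

text \<open>
  Recurrence depends only on the topology. Stating it for topologies lets it apply to
  product systems through \<^const>\<open>prod_topology\<close>, without choosing a product metric.
\<close>

definition recurrent :: "'a topology \<Rightarrow> ('a \<Rightarrow> 'a) \<Rightarrow> 'a \<Rightarrow> bool" where
  "recurrent T f x \<longleftrightarrow>
     x \<in> topspace T \<and> (\<forall>U. openin T U \<and> x \<in> U \<longrightarrow> hitting_times f x U \<noteq> {})"

definition ps_recurrent :: "'a topology \<Rightarrow> ('a \<Rightarrow> 'a) \<Rightarrow> 'a \<Rightarrow> bool" where
  "ps_recurrent T f x \<longleftrightarrow>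
     x \<in> topspace T \<and> (\<forall>U. openin T U \<and> x \<in> U \<longrightarrow> piecewise_syndetic (hitting_times f x U))"

locale dynamical_system = Metric_space X d
  for X :: "'a set" and d :: "'a \<Rightarrow> 'a \<Rightarrow> real" +
  fixes f :: "'a \<Rightarrow> 'a"
  assumes compact: "compact_space mtopology"
    and continuous: "continuous_map mtopology mtopology f"

text \<open>
  HOL cannot quantify over all types inside a formula, so the second system \<open>(Y, g)\<close> ranges
  over all compact metric spaces, with an arbitrary metric, whose points are sequences of reals.
  Up to isometry these are all compact metric spaces; \<open>ps_product_recurrent_any_type\<close> below
  proves that the property then holds for systems on an arbitrary type.
\<close>

definition ps_product_recurrent ::
    "'a set \<Rightarrow> ('a \<Rightarrow> 'a \<Rightarrow> real) \<Rightarrow> ('a \<Rightarrow> 'a) \<Rightarrow> 'a \<Rightarrow> bool" where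
  "ps_product_recurrent X d f x \<longleftrightarrow>
     recurrent (Metric_space.mtopology X d) f x \<and>
     (\<forall>(Y :: (nat \<Rightarrow> real) set) e g y.
        dynamical_system Y e g \<and> ps_recurrent (Metric_space.mtopology Y e) g y \<longrightarrow>
        recurrent (prod_topology (Metric_space.mtopology X d) (Metric_space.mtopology Y e))
          (map_prod f g) (x, y))"

definition proximal :: "('a \<Rightarrow> 'a \<Rightarrow> real) \<Rightarrow> ('a \<Rightarrow> 'a) \<Rightarrow> 'a \<Rightarrow> 'a \<Rightarrow> bool" where
  "proximal d f x y \<longleftrightarrow>
     (\<exists>r :: nat \<Rightarrow> nat. strict_mono r \<and> (\<forall>k. r k \<ge> 1) \<and>
        (\<lambda>k. d ((f ^^ r k) x) ((f ^^ r k) y)) \<longlonglongrightarrow> 0)"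

definition orbit_closure :: "'a set \<Rightarrow> ('a \<Rightarrow> 'a \<Rightarrow> real) \<Rightarrow> ('a \<Rightarrow> 'a) \<Rightarrow> 'a \<Rightarrow> 'a set" where
  "orbit_closure X d f x = (Metric_space.mtopology X d) closure_of {(f ^^ n) x |n. n \<ge> 1}"

definition distal_point :: "'a set \<Rightarrow> ('a \<Rightarrow> 'a \<Rightarrow> real) \<Rightarrow> ('a \<Rightarrow> 'a) \<Rightarrow> 'a \<Rightarrow> bool" where
  "distal_point X d f x \<longleftrightarrow>
     x \<in> X \<and> (\<forall>y \<in> orbit_closure X d f x. y \<noteq> x \<longrightarrow> \<not> proximal d f x y)"

lemma compact_metric_inj_real_sequences:
  assumes "Metric_space Y e" and "compact_space (Metric_space.mtopology Y e)"
  obtains h :: "'b \<Rightarrow> nat \<Rightarrow> real" where "inj_on h Y"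
proof (cases "Y = {}")
  case True
  then show ?thesis using that by auto
next
  case False
  interpret Metric_space Y e by fact
  have tb: "mtotally_bounded Y"
    using assms(2) compact_space_eq_mcomplete_mtotally_bounded by blast
  have "\<forall>n. \<exists>K. finite K \<and> K \<subseteq> Y \<and> Y \<subseteq> (\<Union>x\<in>K. mball x (inverse (real (Suc n))))"
    using tb unfolding mtotally_bounded_def by simp
  then obtain K where K: "\<And>n. finite (K n)" "\<And>n. K n \<subseteq> Y"
    "\<And>n. Y \<subseteq> (\<Union>x\<in>K n. mball x (inverse (real (Suc n))))"
    by metis
  define D where "D = (\<Union>n. K n)"
  have cD: "countable D" unfolding D_def by (simp add: K(1) countable_finite)
  have DY: "D \<subseteq> Y" unfolding D_def using K(2) by blast
  have neD: "D \<noteq> {}" unfolding D_def using K(3)[of 0] False by blast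
  have "inj_on (\<lambda>y n. e y (from_nat_into D n)) Y"
  proof (rule inj_onI, rule ccontr)
    fix y z assume yz: "y \<in> Y" "z \<in> Y" and "y \<noteq> z"
      and eq: "(\<lambda>n. e y (from_nat_into D n)) = (\<lambda>n. e z (from_nat_into D n))"
    then have "e y z / 2 > 0" by simp
    then obtain n where n: "inverse (real (Suc n)) < e y z / 2"
      using reals_Archimedean by blast
    obtain a where a: "a \<in> K n" "e a y < inverse (real (Suc n))"
      using K(3)[of n] yz(1) by fastforce
    then have "a \<in> D" unfolding D_def by blast
    then obtain m where "a = from_nat_into D m"
      by (metis cD from_nat_into_surj)
    then have "e y a = e z a" using eq by metis
    moreover have "e y z \<le> e y a + e a z" using triangle yz \<open>a \<in> D\<close> DY by blast
    ultimately show False using n a(2) commute[of a] by (metis field_sum_of_halves add_mono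
          dual_order.strict_trans less_eq_real_def linorder_not_le add_strict_mono)
  qed
  then show ?thesis using that by blast
qed

lemma hitting_times_conj:
  assumes "f \<in> X \<rightarrow> X" and "\<And>w. w \<in> X \<Longrightarrow> g (h w) = h (f w)" and "x \<in> X"
  shows "(f ^^ n) x \<in> X" and "(g ^^ n) (h x) = h ((f ^^ n) x)"
proof -
  have "(f ^^ n) x \<in> X \<and> (g ^^ n) (h x) = h ((f ^^ n) x)"
    by (induction n) (use assms in auto)
  then show "(f ^^ n) x \<in> X" and "(g ^^ n) (h x) = h ((f ^^ n) x)" by auto
qed

lemma ps_product_recurrent_any_type:
  fixes Y :: "'b set"
  assumes PR: "ps_product_recurrent X d f x"
    and sys: "dynamical_system Y e g"
    and rec: "ps_recurrent (Metric_space.mtopology Y e) g y"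
  shows "recurrent (prod_topology (Metric_space.mtopology X d) (Metric_space.mtopology Y e))
           (map_prod f g) (x, y)"
proof -
  interpret Y: dynamical_system Y e g by fact
  obtain h :: "'b \<Rightarrow> nat \<Rightarrow> real" where inj: "inj_on h Y"
    using compact_metric_inj_real_sequences[OF Y.Metric_space_axioms Y.compact] .
  define k where "k = inv_into Y h"
  define Z where "Z = h ` Y"
  define E where "E u v = e (k u) (k v)" for u v
  define G where "G = h \<circ> g \<circ> k"
  have kh: "k (h w) = w" if "w \<in> Y" for w using inj that by (simp add: k_def)
  have hk: "h (k z) = z" "k z \<in> Y" if "z \<in> Z" for z
    using that unfolding k_def Z_def by (auto simp: f_inv_into_f inv_into_into)
  have yY: "y \<in> Y" using rec by (simp add: ps_recurrent_def)
  interpret Z: Metric_space Z E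
  proof
    show "E u v = 0 \<longleftrightarrow> u = v" if "u \<in> Z" "v \<in> Z" for u v
      using hk[OF that(1)] hk[OF that(2)] unfolding E_def by (metis Y.zero)
    show "E u w \<le> E u v + E v w" if "u \<in> Z" "v \<in> Z" "w \<in> Z" for u v w
      using hk that unfolding E_def by (simp add: Y.triangle)
  qed (auto simp: E_def Y.commute)
  interpret YZ: Metric_space12 Y e Z E by unfold_locales
  interpret ZY: Metric_space12 Z E Y e by unfold_locales
  have homh: "homeomorphic_map Y.mtopology Z.mtopology h"
    by (rule YZ.isometry_imp_homeomorphic_map) (auto simp: Z_def E_def kh)
  have homk: "homeomorphic_map Z.mtopology Y.mtopology k"
    by (rule ZY.isometry_imp_homeomorphic_map)
      (auto simp: E_def Z_def kh image_image)
  have ch: "continuous_map Y.mtopology Z.mtopology h" 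
    and ck: "continuous_map Z.mtopology Y.mtopology k"
    using homh homk homeomorphic_imp_continuous_map by blast+
  have cG: "continuous_map Z.mtopology Z.mtopology G"
    unfolding G_def by (intro continuous_map_compose[OF ck] continuous_map_compose[OF Y.continuous] ch)
  have cZ: "compact_space Z.mtopology"
    using Y.compact homh homeomorphic_compact_space homeomorphic_map_imp_homeomorphic_space by blast
  have sysZ: "dynamical_system Z E G"
    using Z.Metric_space_axioms cZ cG by (simp add: dynamical_system_def dynamical_system_axioms_def)
  have gY: "g \<in> Y \<rightarrow> Y" using Y.continuous by (auto simp: continuous_map_def)
  have it: "(G ^^ n) (h y) = h ((g ^^ n) y)" "(g ^^ n) y \<in> Y" for n
    by (rule hitting_times_conj[OF gY _ yY]; simp add: G_def kh)+
  have hit: "hitting_times G (h y) V = hitting_times g y {w \<in> Y. h w \<in> V}" for V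
    using it by (auto simp: hitting_times_def)
  have recZ: "ps_recurrent Z.mtopology G (h y)"
    unfolding ps_recurrent_def
  proof (intro conjI allI impI)
    show "h y \<in> topspace Z.mtopology" using yY unfolding Z.topspace_mtopology by (simp add: Z_def)
    fix V assume "openin Z.mtopology V \<and> h y \<in> V"
    moreover from this have "openin Y.mtopology {w \<in> Y. h w \<in> V}"
      using openin_continuous_map_preimage[OF ch] by simp
    ultimately show "piecewise_syndetic (hitting_times G (h y) V)"
      using rec yY unfolding hit ps_recurrent_def by simp
  qed
  let ?T = "Metric_space.mtopology X d"
  have xX: "x \<in> topspace ?T" using PR by (simp add: ps_product_recurrent_def recurrent_def)
  have R: "recurrent (prod_topology ?T Z.mtopology) (map_prod f G) (x, h y)"
    using PR sysZ recZ unfolding ps_product_recurrent_def by blast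
  show ?thesis
    unfolding recurrent_def
  proof (intro conjI allI impI)
    show "(x, y) \<in> topspace (prod_topology ?T Y.mtopology)" using xX yY by simp
    fix W assume W: "openin (prod_topology ?T Y.mtopology) W \<and> (x, y) \<in> W"
    let ?W = "{p \<in> topspace (prod_topology ?T Z.mtopology). (fst p, k (snd p)) \<in> W}"
    have "continuous_map (prod_topology ?T Z.mtopology) (prod_topology ?T Y.mtopology)
            (\<lambda>p. (fst p, k (snd p)))"
      by (intro continuous_map_pairedI continuous_map_fst
          continuous_map_compose[OF continuous_map_snd ck, unfolded comp_def])
    then have "openin (prod_topology ?T Z.mtopology) ?W"
      using W openin_continuous_map_preimage by blast
    moreover have "h y \<in> Z" using yY by (simp add: Z_def)
    then have "(x, h y) \<in> ?W" using W xX yY by (simp add: kh)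
    ultimately have "hitting_times (map_prod f G) (x, h y) ?W \<noteq> {}"
      using R unfolding recurrent_def by blast
    then obtain n where n: "n \<ge> 1" "(map_prod f G ^^ n) (x, h y) \<in> ?W"
      by (auto simp: hitting_times_def)
    have mp: "(map_prod a b ^^ n) (u, v) = ((a ^^ n) u, (b ^^ n) v)"
      for a :: "'c \<Rightarrow> 'c" and b :: "'d \<Rightarrow> 'd" and u v by (induction n) auto
    have "((f ^^ n) x, (g ^^ n) y) \<in> W" using n(2) by (simp add: mp it kh)
    then show "hitting_times (map_prod f g) (x, y) W \<noteq> {}"
      using n(1) by (auto simp: hitting_times_def mp)
  qed
qed

end

theory Submission
  imports Defs
begin

text \<open>
  Call a set of times \<open>A\<close> translatable if every finite \<open>B \<subseteq> A\<close> has piecewise syndetically many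
  \<open>n \<in> A\<close> with \<open>n + B \<subseteq> A\<close>. A translatable set contains a set \<open>C\<close> such that each initial segment of
  \<open>C \<union> {0}\<close> reappears in \<open>C\<close> exactly, along a piecewise syndetic set of times
  (\<open>self_replicating_subset_exists\<close>). The indicator sequence of \<open>C \<union> {0}\<close> is then a point of the
  full shift for which every neighbourhood has a piecewise syndetic set of return times, and it
  returns to the cylinder of the symbol \<open>1\<close> only at times in \<open>C\<close>. Consequently, if \<open>x\<close> is product
  recurrent with all such points, then the return times of \<open>x\<close> to each of its neighbourhoods meet
  every translatable set (\<open>ps_product_recurrent_hits\<close>).

  This is applied twice. Thick sets are translatable, so the return times of \<open>x\<close> to each ball
  around it meet every thick set; hence they are syndetic and \<open>x\<close> is uniformly recurrent, and
  with it every point of its orbit closure. Now suppose that \<open>x\<close> is proximal to a point \<open>y \<noteq> x\<close> of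
  its orbit closure. The times at which both \<open>x\<close> and \<open>y\<close> visit a small ball around \<open>y\<close> form a
  translatable set, because \<open>y\<close> returns close to itself syndetically often while proximality
  keeps \<open>x\<close> close to \<open>y\<close> on arbitrarily long intervals (\<open>joint_hitting_times_translation\<close>). So at
  one of these times \<open>x\<close> returns to a given small ball around itself. But the ball around \<open>x\<close> and
  the ball around \<open>y\<close> can be chosen disjoint, a contradiction.
\<close>

section \<open>Piecewise syndetic sets\<close>

text \<open>
  This form involves no auxiliary thick or syndetic set, only one finite condition for each length
  \<open>L\<close>, so it can be arranged step by step in a construction.
\<close>

lemma piecewise_syndetic_iff:
  "piecewise_syndetic F \<longleftrightarrow>
     F \<subseteq> {1..} \<and> (\<exists>N. \<forall>L. \<exists>a\<ge>1. \<forall>i\<in>{a..a + L}. {i..i + N} \<inter> F \<noteq> {})"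
proof (intro iffI conjI)
  assume "piecewise_syndetic F"
  then obtain T S where T: "thick T" and S: "syndetic S" and F: "F = T \<inter> S"
    unfolding piecewise_syndetic_def by blast
  show "F \<subseteq> {1..}" using T F by (auto simp: thick_def)
  obtain N where N: "\<forall>i\<ge>1. {i..i + N} \<inter> S \<noteq> {}"
    using S unfolding syndetic_def by blast
  have "\<exists>a\<ge>1. \<forall>i\<in>{a..a + L}. {i..i + N} \<inter> F \<noteq> {}" for L
  proof -
    obtain a where a: "a \<ge> 1" "{a..a + (L + N + 1)} \<subseteq> T"
      using T unfolding thick_def by (metis add_gr_0 zero_less_one)
    have "{i..i + N} \<inter> F \<noteq> {}" if i: "i \<in> {a..a + L}" for i
    proof -
      have "i \<ge> 1" using i a by auto
      then obtain s where s: "s \<in> {i..i + N}" "s \<in> S" using N by blast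
      then have "s \<in> {a..a + (L + N + 1)}" using i by auto
      then show ?thesis using s a(2) F by blast
    qed
    then show ?thesis using a(1) by blast
  qed
  then show "\<exists>N. \<forall>L. \<exists>a\<ge>1. \<forall>i\<in>{a..a + L}. {i..i + N} \<inter> F \<noteq> {}" by blast
next
  assume "F \<subseteq> {1..} \<and> (\<exists>N. \<forall>L. \<exists>a\<ge>1. \<forall>i\<in>{a..a + L}. {i..i + N} \<inter> F \<noteq> {})"
  then obtain N where F1: "F \<subseteq> {1..}"
    and N: "\<forall>L. \<exists>a\<ge>1. \<forall>i\<in>{a..a + L}. {i..i + N} \<inter> F \<noteq> {}" by blast
  \<comment> \<open>The good starting points form a thick set; \<open>F\<close> is added to both factors so that their
    intersection is exactly \<open>F\<close>.\<close>
  define G where "G = {i. i \<ge> 1 \<and> {i..i + N} \<inter> F \<noteq> {}}"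
  define T where "T = F \<union> G"
  define S where "S = F \<union> ({1..} - T)"
  have "thick T"
    unfolding thick_def
  proof (intro conjI allI impI)
    show "T \<subseteq> {1..}" using F1 by (auto simp: T_def G_def)
    fix n :: nat
    obtain a where "a \<ge> 1" "\<forall>i\<in>{a..a + n}. {i..i + N} \<inter> F \<noteq> {}" using N by blast
    then have "{a..a + n} \<subseteq> T" by (auto simp: T_def G_def)
    then show "\<exists>i\<ge>1. {i..i + n} \<subseteq> T" using \<open>a \<ge> 1\<close> by blast
  qed
  moreover have "syndetic S"
    unfolding syndetic_def
  proof (intro conjI exI allI impI)
    show "S \<subseteq> {1..}" using F1 by (auto simp: S_def)
    show "1 \<le> N + 1" by simp
    fix i :: nat assume i: "1 \<le> i"
    show "{i..i + (N + 1)} \<inter> S \<noteq> {}"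
    proof (cases "i \<in> G")
      case True
      then obtain s where "s \<in> {i..i + N}" "s \<in> F" unfolding G_def by blast
      then have "s \<in> {i..i + (N + 1)} \<inter> S" by (auto simp: S_def)
      then show ?thesis by blast
    next
      case False
      then have "i \<in> S" using i by (auto simp: S_def T_def)
      then show ?thesis by fastforce
    qed
  qed
  moreover have "F = T \<inter> S" by (auto simp: T_def S_def)
  ultimately show "piecewise_syndetic F" unfolding piecewise_syndetic_def by blast
qed

lemma piecewise_syndetic_mono:
  assumes "piecewise_syndetic F" "F \<subseteq> G" "G \<subseteq> {1..}"
  shows "piecewise_syndetic G"
proof -
  obtain N where N: "\<forall>L. \<exists>a\<ge>1. \<forall>i\<in>{a..a + L}. {i..i + N} \<inter> F \<noteq> {}"
    using assms(1) unfolding piecewise_syndetic_iff by blast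
  have "\<forall>L. \<exists>a\<ge>1. \<forall>i\<in>{a..a + L}. {i..i + N} \<inter> G \<noteq> {}"
    using N assms(2) by (meson disjoint_iff subsetD)
  then show ?thesis using assms(3) unfolding piecewise_syndetic_iff by blast
qed

lemma thick_imp_piecewise_syndetic:
  assumes "thick F"
  shows "piecewise_syndetic F"
proof -
  have "syndetic {1..}" by (fastforce simp: syndetic_def)
  moreover have "F = F \<inter> {1..}" using assms by (auto simp: thick_def)
  ultimately show ?thesis using assms unfolding piecewise_syndetic_def by blast
qed

lemma thick_compl_not_syndetic:
  assumes "F \<subseteq> {1..}" "\<not> syndetic F"
  shows "thick ({1..} - F)"
  unfolding thick_def
proof (intro conjI allI impI)
  fix n :: nat assume "n > 0"
  then obtain i where i: "i \<ge> 1" "{i..i + n} \<inter> F = {}"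
    using assms unfolding syndetic_def by (metis Suc_leI One_nat_def)
  then have "{i..i + n} \<subseteq> {1..} - F" by auto
  then show "\<exists>i\<ge>1. {i..i + n} \<subseteq> {1..} - F" using i(1) by blast
qed auto

section \<open>Sets that replicate their own initial segments\<close>

definition translation_times :: "nat set \<Rightarrow> nat set \<Rightarrow> nat set" where
  "translation_times A D = {n \<in> A. \<forall>t\<in>D. n + t \<in> A}"

lemma thick_translation_times:
  assumes A: "thick A" and B: "finite B"
  shows "thick (translation_times A B)"
  unfolding thick_def
proof (intro conjI allI impI)
  show "translation_times A B \<subseteq> {1..}"
    using A by (auto simp: thick_def translation_times_def)
  fix n :: nat assume "n > 0"
  obtain K where K: "B \<subseteq> {..K}" using B finite_nat_iff_bounded_le by blast
  obtain a where a: "a \<ge> 1" "{a..a + (n + K)} \<subseteq> A"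
    using A \<open>n > 0\<close> unfolding thick_def by (metis add_gr_0)
  have "m \<in> translation_times A B" if "m \<in> {a..a + n}" for m
  proof -
    have "m + t \<in> A" if "t \<le> K" for t using a(2) \<open>m \<in> {a..a + n}\<close> that by auto
    from this[of 0] this show ?thesis using K by (auto simp: translation_times_def)
  qed
  then show "\<exists>i\<ge>1. {i..i + n} \<subseteq> translation_times A B" using a(1) by blast
qed

text \<open>
  One step of the construction of a self-replicating set. The times at which \<open>insert 0 D\<close> can be
  translated into \<open>A\<close> have gaps at most \<open>N\<close> on long intervals, so translates that do not
  interfere with each other can be placed beyond \<open>b\<close>, with gaps that depend on \<open>N\<close> and \<open>k\<close> but
  not on the length \<open>l\<close> of the stretch to be covered. The independence of \<open>l\<close> is what makes
  the final set replicate itself along piecewise syndetic sets of times.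
\<close>

lemma append_translates:
  fixes A B D :: "nat set" and b k l N :: nat
  assumes B: "finite B" "B \<subseteq> A" "B \<subseteq> {..<b}" and D: "D \<subseteq> {..k}"
    and gap: "\<forall>L. \<exists>a\<ge>1. \<forall>i\<in>{a..a + L}. {i..i + N} \<inter> translation_times A D \<noteq> {}"
  obtains B' b' where "finite B'" "B' \<subseteq> A" "B' \<subseteq> {..<b'}" "b < b'" "B' \<inter> {..<b} = B"
    and "\<exists>a\<ge>1. \<forall>i\<in>{a..a + l}. \<exists>n\<in>{i..i + 2 * (N + k + 1)}.
           \<forall>t\<le>k. n + t < b' \<and> (n + t \<in> B' \<longleftrightarrow> t \<in> insert 0 D)"
proof -
  \<comment> \<open>Consecutive blocks of length \<open>M\<close>: each contains a translation time in its first \<open>N + 1\<close>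
    places, which leaves room for a window of length \<open>k + 1\<close> before the next block.\<close>
  define M where "M = N + k + 1"
  obtain a0 where a0: "\<forall>i\<in>{a0..a0 + (b + l * M + 1)}. {i..i + N} \<inter> translation_times A D \<noteq> {}"
    using gap by blast
  \<comment> \<open>Starting beyond \<open>b\<close> leaves the elements of \<open>B\<close> untouched.\<close>
  define a where "a = a0 + b + 1"
  have "\<forall>q\<le>l. \<exists>n. n \<in> {a + q * M..a + q * M + N} \<and> n \<in> translation_times A D"
  proof (intro allI impI)
    fix q assume "q \<le> l"
    then have "q * M \<le> l * M" by simp
    then have "a + q * M \<in> {a0..a0 + (b + l * M + 1)}" unfolding a_def by simp
    then show "\<exists>n. n \<in> {a + q * M..a + q * M + N} \<and> n \<in> translation_times A D"
      using a0 by blast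
  qed
  then obtain s where s: "\<And>q. q \<le> l \<Longrightarrow> s q \<in> {a + q * M..a + q * M + N}"
    "\<And>q. q \<le> l \<Longrightarrow> s q \<in> translation_times A D" by metis
  define new where "new = (\<Union>q\<in>{..l}. (\<lambda>t. s q + t) ` insert 0 D)"
  define b' where "b' = a + Suc l * M"
  have finD: "finite D" using D finite_subset by blast
  have bound: "s q + t < a + Suc q * M" if "q \<le> l" "t \<le> k" for q t
    using s(1)[OF that(1)] that(2) by (simp add: M_def)
  have ge: "a + q * M \<le> s q" if "q \<le> l" for q using s(1)[OF that] by simp
  have below: "s q + t < b'" if "q \<le> l" "t \<le> k" for q t
  proof -
    have "Suc q * M \<le> Suc l * M" using that by (intro mult_le_mono1) simp
    then show ?thesis using bound[OF that] unfolding b'_def by linarith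
  qed
  have newI: "s q + t \<in> new" if "q \<le> l" "t \<in> insert 0 D" for q t
    using that unfolding new_def by blast
  have newE: "\<exists>q t. q \<le> l \<and> t \<in> insert 0 D \<and> t \<le> k \<and> m = s q + t" if "m \<in> new" for m
    using that D unfolding new_def by fastforce
  have new_ge: "a \<le> m" "m < b'" "m \<in> A" if m: "m \<in> new" for m
  proof -
    obtain q t where qt: "q \<le> l" "t \<in> insert 0 D" "t \<le> k" "m = s q + t"
      using newE[OF m] by blast
    show "a \<le> m" using ge[OF qt(1)] qt(4) by linarith
    show "m < b'" using below[OF qt(1,3)] qt(4) by simp
    show "m \<in> A" using s(2)[OF qt(1)] qt(2,4) by (auto simp: translation_times_def)
  qed
  \<comment> \<open>A window of length \<open>k + 1\<close> that starts in block \<open>q\<close> ends before block \<open>q + 1\<close>, so it sees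
    one translate only.\<close>
  have pattern: "s q + t \<in> B \<union> new \<longleftrightarrow> t \<in> insert 0 D" if q: "q \<le> l" and t: "t \<le> k" for q t
  proof
    assume "s q + t \<in> B \<union> new"
    moreover have "s q + t \<notin> B" using ge[OF q] B(3) unfolding a_def by fastforce
    ultimately have "s q + t \<in> new" by blast
    then obtain p u where pu: "p \<le> l" "u \<in> insert 0 D" "u \<le> k" "s q + t = s p + u"
      using newE by blast
    have "\<not> Suc p * M \<le> q * M" "\<not> Suc q * M \<le> p * M"
      using bound[OF q t] bound[OF pu(1,3)] ge[OF q] ge[OF pu(1)] pu(4) by linarith+
    then have "\<not> Suc p \<le> q" "\<not> Suc q \<le> p" using mult_le_mono1 by blast+
    then have "p = q" by simp
    then show "t \<in> insert 0 D" using pu by simp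
  qed (use newI[OF q] in blast)
  show ?thesis
  proof
    show "finite (B \<union> new)" using B(1) finD by (simp add: new_def)
    show "B \<union> new \<subseteq> A" using B(2) new_ge(3) by blast
    have "b < b'" unfolding b'_def a_def by simp
    then show "b < b'" .
    show "B \<union> new \<subseteq> {..<b'}" using B(3) new_ge(2) \<open>b < b'\<close> by fastforce
    show "(B \<union> new) \<inter> {..<b} = B" using B(3) new_ge(1) unfolding a_def by fastforce
    have "\<exists>n\<in>{i..i + 2 * M}. \<forall>t\<le>k. n + t < b' \<and> (n + t \<in> B \<union> new \<longleftrightarrow> t \<in> insert 0 D)"
      if i: "i \<in> {a..a + l}" for i
    proof -
      \<comment> \<open>Some block starts within \<open>M\<close> steps after \<open>i\<close>.\<close>
      define q where "q = (i - a + (M - 1)) div M"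
      have M: "M > 0" by (simp add: M_def)
      have e: "q * M + (i - a + (M - 1)) mod M = i - a + (M - 1)"
        unfolding q_def by simp
      have "(i - a + (M - 1)) mod M < M" using M by simp
      then have q1: "i - a \<le> q * M" "q * M \<le> i - a + (M - 1)" using e by linarith+
      have "q \<le> l"
      proof (rule ccontr)
        assume "\<not> q \<le> l"
        then have "Suc l * M \<le> q * M" by (intro mult_le_mono1) simp
        moreover have "l \<le> l * M" using M by simp
        moreover have "i - a \<le> l" using i by auto
        ultimately show False using q1(2) M unfolding mult_Suc by linarith
      qed
      have "s q \<in> {i..i + 2 * M}"
      proof -
        have "a \<le> i" "N < M" using i by (auto simp: M_def)
        moreover have "a + q * M \<le> s q" "s q \<le> a + q * M + N"
          using s(1)[OF \<open>q \<le> l\<close>] by simp_all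
        ultimately have "i \<le> s q" "s q \<le> i + 2 * M" using q1 by linarith+
        then show ?thesis by simp
      qed
      moreover have "\<forall>t\<le>k. s q + t < b' \<and> (s q + t \<in> B \<union> new \<longleftrightarrow> t \<in> insert 0 D)"
        using below[OF \<open>q \<le> l\<close>] pattern[OF \<open>q \<le> l\<close>] by simp
      ultimately show ?thesis by (rule bexI[rotated])
    qed
    then show "\<exists>a\<ge>1. \<forall>i\<in>{a..a + l}. \<exists>n\<in>{i..i + 2 * (N + k + 1)}.
           \<forall>t\<le>k. n + t < b' \<and> (n + t \<in> B \<union> new \<longleftrightarrow> t \<in> insert 0 D)"
      unfolding M_def by (intro exI[of _ a]) (simp add: a_def)
  qed
qed

text \<open>
  The combinatorial core. The set \<open>C\<close> is a union of finite stages. Stage \<open>j\<close> encodes a task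
  \<open>(k, l)\<close>: append translates of the initial segment of length \<open>k\<close> so that they occur with bounded
  gaps along a stretch of length \<open>l\<close>. Every element added at stage \<open>j\<close> is larger than \<open>j \<ge> k\<close>, so
  the segment to be copied is already final when the task is treated. The bound on the gaps
  depends only on this segment, whereas all lengths \<open>l\<close> occur; hence the times of replication are
  piecewise syndetic. The point \<open>0\<close> belongs to the copied pattern because a translate must also
  reproduce the starting symbol of the sequence that \<open>C\<close> will encode.
\<close>

lemma self_replicating_subset_exists:
  fixes A :: "nat set"
  assumes A: "\<And>B. finite B \<Longrightarrow> B \<subseteq> A \<Longrightarrow> piecewise_syndetic (translation_times A B)"
  shows "\<exists>C\<subseteq>A. \<forall>k.
    piecewise_syndetic {n. n \<ge> 1 \<and> (\<forall>t\<le>k. n + t \<in> C \<longleftrightarrow> t \<in> insert 0 C)}"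
proof -
  have "\<exists>N. \<forall>L. \<exists>a\<ge>1. \<forall>i\<in>{a..a + L}. {i..i + N} \<inter> translation_times A D \<noteq> {}"
    if "finite D" "D \<subseteq> A" for D
    using A[OF that] unfolding piecewise_syndetic_iff by blast
  then obtain gap where gap: "\<And>D. finite D \<Longrightarrow> D \<subseteq> A \<Longrightarrow>
      \<forall>L. \<exists>a\<ge>1. \<forall>i\<in>{a..a + L}. {i..i + gap D} \<inter> translation_times A D \<noteq> {}"
    by metis
  define reached where "reached k l D B' b' \<longleftrightarrow>
    (\<exists>a\<ge>1. \<forall>i\<in>{a..a + l}. \<exists>n\<in>{i..i + 2 * (gap D + k + 1)}.
           \<forall>t\<le>k. n + t < b' \<and> (n + t \<in> B' \<longleftrightarrow> t \<in> insert 0 D))" for k l D B' b'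
  \<comment> \<open>A state is a finite stage together with a strict upper bound \<open>b\<close> of its elements; all later
    elements are at least \<open>b\<close>.\<close>
  define P where "P j = (\<lambda>(B, b). finite B \<and> B \<subseteq> A \<and> B \<subseteq> {..<b} \<and> j < b)" for j :: nat
  define Q where "Q j = (\<lambda>(B, b) (B', b'). b < b' \<and> B' \<inter> {..<b} = B \<and>
    (case prod_decode j of (k, l) \<Rightarrow> reached k l (B \<inter> {..k}) B' b'))"
    for j :: nat
  have "\<exists>S. \<forall>j. P j (S j) \<and> Q j (S j) (S (Suc j))"
  proof (rule dependent_nat_choice)
    have "P 0 ({}, 1)" by (simp add: P_def)
    then show "\<exists>x. P 0 x" by blast
  next
    fix Bb and j :: nat assume PB: "P j Bb"
    obtain B b where Bb: "Bb = (B, b)" by force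
    obtain k l where kl: "prod_decode j = (k, l)" by force
    have B: "finite B" "B \<subseteq> A" "B \<subseteq> {..<b}" "j < b" using PB by (auto simp: P_def Bb)
    have D: "B \<inter> {..k} \<subseteq> {..k}" "finite (B \<inter> {..k})" "B \<inter> {..k} \<subseteq> A" using B by auto
    obtain B' b' where B': "finite B'" "B' \<subseteq> A" "B' \<subseteq> {..<b'}" "b < b'" "B' \<inter> {..<b} = B"
      and r: "\<exists>a\<ge>1. \<forall>i\<in>{a..a + l}. \<exists>n\<in>{i..i + 2 * (gap (B \<inter> {..k}) + k + 1)}.
           \<forall>t\<le>k. n + t < b' \<and> (n + t \<in> B' \<longleftrightarrow> t \<in> insert 0 (B \<inter> {..k}))"
      by (rule append_translates[OF B(1-3) D(1) gap[OF D(2,3)], where l = l])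
    have "P (Suc j) (B', b')" using B' B(4) by (simp add: P_def)
    moreover have "Q j Bb (B', b')"
      using B' r kl by (simp add: Q_def Bb reached_def)
    ultimately show "\<exists>y. P (Suc j) y \<and> Q j Bb y" by blast
  qed
  then obtain S where S: "\<And>j. P j (S j)" "\<And>j. Q j (S j) (S (Suc j))" by blast
  define B where "B j = fst (S j)" for j
  define b where "b j = snd (S j)" for j
  have Sj: "S j = (B j, b j)" for j by (simp add: B_def b_def)
  have B: "B j \<subseteq> A" "B j \<subseteq> {..<b j}" "j < b j" for j
    using S(1)[of j] by (auto simp: P_def Sj)
  have step: "b j < b (Suc j)" "B (Suc j) \<inter> {..<b j} = B j" for j
    using S(2)[of j] by (auto simp: Q_def Sj)
  have bmono: "b i \<le> b j" if "i \<le> j" for i j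
    by (rule lift_Suc_mono_le[of b, OF less_imp_le[OF step(1)] that])
  have stable: "B j \<inter> {..<b i} = B i" if "i \<le> j" for i j
    using that
  proof (induction rule: dec_induct)
    case base
    then show ?case using B(2) by blast
  next
    case (step n)
    have "B (Suc n) \<inter> {..<b i} = B (Suc n) \<inter> {..<b n} \<inter> {..<b i}"
      using bmono[OF step(1)] by fastforce
    then show ?case using \<open>B (Suc n) \<inter> {..<b n} = B n\<close> step.IH by simp
  qed
  define C where "C = (\<Union>j. B j)"
  have CB: "m \<in> C \<longleftrightarrow> m \<in> B j" if "m < b j" for m j
  proof
    assume "m \<in> C"
    then obtain i where i: "m \<in> B i" by (auto simp: C_def)
    show "m \<in> B j"
    proof (cases "i \<le> j")
      case True
      then show ?thesis using stable[OF True] i by blast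
    next
      case False
      then have "B i \<inter> {..<b j} = B j" by (intro stable) simp
      then show ?thesis using i that by blast
    qed
  qed (auto simp: C_def)
  show ?thesis
  proof (intro exI[of _ C] conjI allI)
    show "C \<subseteq> A" using B(1) by (auto simp: C_def)
    fix k
    define D where "D = C \<inter> {..k}"
    let ?R = "{n. n \<ge> 1 \<and> (\<forall>t\<le>k. n + t \<in> C \<longleftrightarrow> t \<in> insert 0 C)}"
    have "\<exists>a\<ge>1. \<forall>i\<in>{a..a + l}. {i..i + 2 * (gap D + k + 1)} \<inter> ?R \<noteq> {}" for l
    proof -
      define j where "j = prod_encode (k, l)"
      have kj: "k \<le> j" unfolding j_def by (rule le_prod_encode_1)
      have "D = B j \<inter> {..k}"
        unfolding D_def using CB[of _ j] B(3)[of j] kj by fastforce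
      then have "reached k l D (B (Suc j)) (b (Suc j))"
        using S(2)[of j] by (simp add: Q_def Sj j_def)
      then obtain a where a: "a \<ge> 1" and r: "\<And>i. i \<in> {a..a + l} \<Longrightarrow>
          \<exists>n\<in>{i..i + 2 * (gap D + k + 1)}.
           \<forall>t\<le>k. n + t < b (Suc j) \<and> (n + t \<in> B (Suc j) \<longleftrightarrow> t \<in> insert 0 D)"
        unfolding reached_def by blast
      have "{i..i + 2 * (gap D + k + 1)} \<inter> ?R \<noteq> {}" if i: "i \<in> {a..a + l}" for i
      proof -
        obtain n where n: "n \<in> {i..i + 2 * (gap D + k + 1)}"
          "\<And>t. t \<le> k \<Longrightarrow> n + t < b (Suc j) \<and> (n + t \<in> B (Suc j) \<longleftrightarrow> t \<in> insert 0 D)"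
          using r[OF i] by blast
        have "n + t \<in> C \<longleftrightarrow> t \<in> insert 0 C" if "t \<le> k" for t
          using n(2)[OF that] CB[of "n + t" "Suc j"] that unfolding D_def by auto
        moreover have "n \<ge> 1" using n(1) i a by auto
        ultimately have "n \<in> ?R" by blast
        then show ?thesis using n(1) by blast
      qed
      then show ?thesis using a by blast
    qed
    then have "\<exists>N. \<forall>l. \<exists>a\<ge>1. \<forall>i\<in>{a..a + l}. {i..i + N} \<inter> ?R \<noteq> {}"
      by (intro exI[of _ "2 * (gap D + k + 1)"]) blast
    then show "piecewise_syndetic ?R" unfolding piecewise_syndetic_iff by auto
  qed
qed

section \<open>Encoding a set of times as a point of the full shift\<close>

definition binary_sequences :: "(nat \<Rightarrow> real) set" where
  "binary_sequences = {z. \<forall>n. z n \<in> {0, 1}}"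

definition shift :: "(nat \<Rightarrow> real) \<Rightarrow> nat \<Rightarrow> real" where
  "shift z = (\<lambda>n. z (Suc n))"

lemma shift_power: "(shift ^^ n) z = (\<lambda>i. z (n + i))"
  by (induction n) (auto simp: shift_def)

lemma mtopology_binary_sequences:
  "Metric_space.mtopology binary_sequences dist = top_of_set binary_sequences"
proof -
  interpret Submetric "UNIV :: (nat \<Rightarrow> real) set" dist binary_sequences
    by unfold_locales auto
  show ?thesis using mtopology_submetric by simp
qed

lemma full_shift_dynamical_system: "dynamical_system binary_sequences dist shift"
proof -
  interpret Submetric "UNIV :: (nat \<Rightarrow> real) set" dist binary_sequences
    by unfold_locales auto
  have eq: "binary_sequences = (\<Pi>\<^sub>E i\<in>UNIV. {0, 1})"
    by (auto simp: binary_sequences_def PiE_def Pi_def)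
  have "compactin (product_topology (\<lambda>i. euclidean) UNIV) binary_sequences"
    unfolding eq by (subst compactin_PiE) (auto intro: finite_imp_compactin)
  then have "compact_space (top_of_set binary_sequences)"
    unfolding euclidean_product_topology by (rule compact_space_subtopology)
  moreover have "continuous_on binary_sequences shift"
    unfolding shift_def
    by (intro continuous_on_coordinatewise_then_product
        continuous_on_subset[OF continuous_on_product_coordinates]) auto
  moreover have "shift \<in> binary_sequences \<rightarrow> binary_sequences"
    by (auto simp: shift_def binary_sequences_def)
  ultimately show ?thesis
    unfolding dynamical_system_def dynamical_system_axioms_def mtopology_binary_sequences
    using sub.Metric_space_axioms by simp
qed

text \<open>
  Cylinders form neighbourhood bases, so recurrence in the shift is about the repetition of
  initial words.
\<close>

lemma open_binary_sequences_cylinder: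
  assumes "openin (top_of_set binary_sequences) U" "z \<in> U"
  obtains k where "\<And>w. w \<in> binary_sequences \<Longrightarrow> (\<forall>t\<le>k. w t = z t) \<Longrightarrow> w \<in> U"
proof -
  obtain V where V: "open V" "U = binary_sequences \<inter> V"
    using assms(1) by (auto simp: openin_open)
  then have "openin (product_topology (\<lambda>i. euclidean) UNIV) V" "z \<in> V"
    using assms(2) by (auto simp: euclidean_product_topology)
  from product_topology_open_contains_basis[OF this]
  obtain W where W: "z \<in> Pi\<^sub>E UNIV W" "finite {i. W i \<noteq> UNIV}" "Pi\<^sub>E UNIV W \<subseteq> V"
    by auto
  obtain k where k: "{i. W i \<noteq> UNIV} \<subseteq> {..k}"
    using W(2) finite_nat_iff_bounded_le by blast
  show ?thesis
  proof
    fix w assume w: "w \<in> binary_sequences" "\<forall>t\<le>k. w t = z t"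
    have "w i \<in> W i" for i
    proof (cases "W i = UNIV")
      case False
      then have "i \<le> k" using k by blast
      then show ?thesis using w(2) W(1) by (auto simp: PiE_iff)
    qed simp
    then have "w \<in> V" using W(3) by (auto simp: PiE_iff)
    then show "w \<in> U" using V w(1) by blast
  qed
qed

lemma indicator_ps_recurrent:
  assumes "\<And>k. piecewise_syndetic {n. n \<ge> 1 \<and> (\<forall>t\<le>k. n + t \<in> C \<longleftrightarrow> t \<in> insert 0 C)}"
  shows "ps_recurrent (top_of_set binary_sequences) shift (indicator (insert 0 C))"
  unfolding ps_recurrent_def
proof (intro conjI allI impI)
  let ?z = "indicator (insert 0 C) :: nat \<Rightarrow> real"
  show "?z \<in> topspace (top_of_set binary_sequences)"
    by (auto simp: binary_sequences_def indicator_def)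
  fix U assume "openin (top_of_set binary_sequences) U \<and> ?z \<in> U"
  then obtain k where k: "\<And>w. w \<in> binary_sequences \<Longrightarrow> (\<forall>t\<le>k. w t = ?z t) \<Longrightarrow> w \<in> U"
    using open_binary_sequences_cylinder by metis
  let ?R = "{n. n \<ge> 1 \<and> (\<forall>t\<le>k. n + t \<in> C \<longleftrightarrow> t \<in> insert 0 C)}"
  have "?R \<subseteq> hitting_times shift ?z U"
  proof
    fix n assume n: "n \<in> ?R"
    have "(shift ^^ n) ?z \<in> U"
    proof (rule k)
      show "(shift ^^ n) ?z \<in> binary_sequences"
        by (auto simp: shift_power binary_sequences_def indicator_def)
      show "\<forall>t\<le>k. (shift ^^ n) ?z t = ?z t"
        using n by (auto simp: shift_power indicator_def)
    qed
    then show "n \<in> hitting_times shift ?z U" using n by (simp add: hitting_times_def)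
  qed
  then show "piecewise_syndetic (hitting_times shift ?z U)"
    by (rule piecewise_syndetic_mono[OF assms]) (auto simp: hitting_times_def)
qed

lemma map_prod_power:
  fixes f :: "'a \<Rightarrow> 'a" and g :: "'b \<Rightarrow> 'b"
  shows "(map_prod f g ^^ n) (x, y) = ((f ^^ n) x, (g ^^ n) y)"
  by (induction n) auto

text \<open>
  The indicator sequence returns to the cylinder of the symbol \<open>1\<close> exactly at the positive
  elements of \<open>C\<close>, so a return time of the pair to \<open>U\<close> times this cylinder belongs to \<open>C\<close>.
\<close>

lemma recurrent_pair_meets:
  assumes PR: "ps_product_recurrent X d f x"
    and rec: "ps_recurrent (top_of_set binary_sequences) shift (indicator (insert 0 C))"
    and U: "openin (Metric_space.mtopology X d) U" "x \<in> U"
  shows "hitting_times f x U \<inter> C \<noteq> {}"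
proof -
  let ?z = "indicator (insert 0 C) :: nat \<Rightarrow> real"
  let ?T = "top_of_set binary_sequences"
  let ?W = "{w \<in> topspace ?T. w 0 \<in> {1/2<..}}"
  have "recurrent (prod_topology (Metric_space.mtopology X d) ?T) (map_prod f shift) (x, ?z)"
    using PR full_shift_dynamical_system rec
    unfolding ps_product_recurrent_def mtopology_binary_sequences[symmetric] by blast
  moreover have "openin ?T ?W"
    by (rule openin_continuous_map_preimage[of _ euclidean])
      (auto intro: continuous_on_subset[OF continuous_on_product_coordinates])
  then have "openin (prod_topology (Metric_space.mtopology X d) ?T) (U \<times> ?W)"
    using U(1) by (simp add: openin_prod_Times_iff)
  moreover have "?z \<in> ?W" by (auto simp: binary_sequences_def indicator_def)
  then have "(x, ?z) \<in> U \<times> ?W" using U(2) by blast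
  ultimately have "hitting_times (map_prod f shift) (x, ?z) (U \<times> ?W) \<noteq> {}"
    unfolding recurrent_def by blast
  then obtain n where n: "n \<ge> 1" "(map_prod f shift ^^ n) (x, ?z) \<in> U \<times> ?W"
    by (auto simp: hitting_times_def)
  then have "(f ^^ n) x \<in> U" "?z n > 1/2" by (auto simp: map_prod_power shift_power)
  then have "n \<in> C" using n(1) by (cases "n \<in> C") (auto simp: indicator_def)
  then show ?thesis using n(1) \<open>(f ^^ n) x \<in> U\<close> by (auto simp: hitting_times_def)
qed

section \<open>Proximality and uniform recurrence in compact systems\<close>

context dynamical_system
begin

lemma self_map: "f \<in> X \<rightarrow> X"
  using continuous_map_funspace[OF continuous] by simp

lemma iterate_in: "u \<in> X \<Longrightarrow> (f ^^ n) u \<in> X"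
  using self_map by (induction n) auto

text \<open>
  By compactness, closeness at one time forces closeness during a prescribed finite time span.
\<close>

lemma iterates_equicontinuous:
  assumes "\<epsilon> > 0"
  obtains \<delta> where "\<delta> > 0"
    and "\<And>u v i. u \<in> X \<Longrightarrow> v \<in> X \<Longrightarrow> d u v < \<delta> \<Longrightarrow> i \<le> L \<Longrightarrow> d ((f ^^ i) u) ((f ^^ i) v) < \<epsilon>"
proof -
  have uc: "\<exists>\<delta>>0. \<forall>u\<in>X. \<forall>v\<in>X. d u v < \<delta> \<longrightarrow> d (f u) (f v) < e" if "e > 0" for e
  proof -
    have "uniformly_continuous_map (metric (X, d)) (metric (X, d)) f"
      using continuous_eq_uniformly_continuous_map[of "metric (X, d)" "metric (X, d)" f]
        compact continuous by (simp add: mtopology_of_def)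
    then show ?thesis using that unfolding uniformly_continuous_map_def
      by simp (metis commute)
  qed
  have "\<exists>\<delta>>0. \<forall>u\<in>X. \<forall>v\<in>X. d u v < \<delta> \<longrightarrow> (\<forall>i\<le>L. d ((f ^^ i) u) ((f ^^ i) v) < \<epsilon>)"
  proof (induction L)
    case 0
    then show ?case using assms by auto
  next
    case (Suc L)
    then obtain e where e: "e > 0"
      "\<forall>u\<in>X. \<forall>v\<in>X. d u v < e \<longrightarrow> (\<forall>i\<le>L. d ((f ^^ i) u) ((f ^^ i) v) < \<epsilon>)" by blast
    obtain \<delta> where \<delta>: "\<delta> > 0" "\<forall>u\<in>X. \<forall>v\<in>X. d u v < \<delta> \<longrightarrow> d (f u) (f v) < e"
      using uc[OF e(1)] by blast
    have "d ((f ^^ i) u) ((f ^^ i) v) < \<epsilon>"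
      if uv: "u \<in> X" "v \<in> X" "d u v < min \<delta> \<epsilon>" and i: "i \<le> Suc L" for u v i
    proof (cases i)
      case 0
      then show ?thesis using uv by simp
    next
      case (Suc j)
      have "d (f u) (f v) < e" "f u \<in> X" "f v \<in> X" using \<delta>(2) uv self_map by auto
      then have "d ((f ^^ j) (f u)) ((f ^^ j) (f v)) < \<epsilon>" using e(2) i Suc by auto
      then show ?thesis by (simp add: Suc funpow_swap1)
    qed
    then show ?case using \<delta>(1) assms by (intro exI[of _ "min \<delta> \<epsilon>"]) auto
  qed
  then show ?thesis using that by blast
qed

lemma proximal_thick:
  assumes xy: "x \<in> X" "y \<in> X" and prox: "proximal d f x y" and "\<epsilon> > 0"
  shows "thick {n. n \<ge> 1 \<and> d ((f ^^ n) x) ((f ^^ n) y) < \<epsilon>}"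
  unfolding thick_def
proof (intro conjI allI impI)
  fix L :: nat
  obtain \<delta> where \<delta>: "\<delta> > 0"
    "\<And>u v i. u \<in> X \<Longrightarrow> v \<in> X \<Longrightarrow> d u v < \<delta> \<Longrightarrow> i \<le> L \<Longrightarrow> d ((f ^^ i) u) ((f ^^ i) v) < \<epsilon>"
    using iterates_equicontinuous[OF \<open>\<epsilon> > 0\<close>] by metis
  obtain r where r: "\<forall>k. r k \<ge> 1" "(\<lambda>k. d ((f ^^ r k) x) ((f ^^ r k) y)) \<longlonglongrightarrow> 0"
    using prox unfolding proximal_def by blast
  have "\<exists>k. d ((f ^^ r k) x) ((f ^^ r k) y) < \<delta>"
    using order_tendstoD(2)[OF r(2) \<delta>(1)] by (auto simp: eventually_sequentially)
  then obtain a where a: "a \<ge> 1" "d ((f ^^ a) x) ((f ^^ a) y) < \<delta>" using r(1) by blast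
  have "d ((f ^^ m) x) ((f ^^ m) y) < \<epsilon>" if "m \<in> {a..a + L}" for m
  proof -
    define i where "i = m - a"
    have i: "m = i + a" "i \<le> L" using that by (auto simp: i_def)
    show ?thesis using \<delta>(2)[OF iterate_in[OF xy(1)] iterate_in[OF xy(2)] a(2) i(2)]
      by (simp add: i(1) funpow_add)
  qed
  then show "\<exists>i\<ge>1. {i..i + L} \<subseteq> {n. n \<ge> 1 \<and> d ((f ^^ n) x) ((f ^^ n) y) < \<epsilon>}"
    using a(1) by (intro exI[of _ a]) auto
qed auto

text \<open>
  By Birkhoff's theorem, the points of \<open>X\<close> with this property are the points of minimal subsystems.
\<close>

definition uniformly_recurrent :: "'a \<Rightarrow> bool" where
  "uniformly_recurrent x \<longleftrightarrow> (\<forall>\<epsilon>>0. syndetic (hitting_times f x (mball x \<epsilon>)))"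

lemma orbit_closure_iff:
  "y \<in> orbit_closure X d f x \<longleftrightarrow>
     y \<in> X \<and> (\<forall>r>0. \<exists>n\<ge>1. (f ^^ n) x \<in> mball y r)"
  unfolding orbit_closure_def metric_closure_of by blast

text \<open>
  A direct form of the fact that all points of a minimal system are uniformly recurrent. The
  return times of \<open>x\<close> to a small ball have gaps at most \<open>N\<close>. Every point of the orbit closure is
  shadowed for \<open>N\<close> steps by a point of the orbit, so it comes close to \<open>x\<close> within \<open>N\<close> steps; from
  there, the \<open>m\<close> steps that bring \<open>x\<close> close to \<open>y\<close> bring it close to \<open>y\<close> as well.
\<close>

lemma uniformly_recurrent_orbit_closure:
  assumes x: "x \<in> X" and ur: "uniformly_recurrent x" and y: "y \<in> orbit_closure X d f x"
  shows "uniformly_recurrent y"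
  unfolding uniformly_recurrent_def
proof (intro allI impI)
  fix \<epsilon> :: real assume \<epsilon>: "\<epsilon> > 0"
  have yX: "y \<in> X" using y by (simp add: orbit_closure_iff)
  obtain m where m: "m \<ge> 1" "d ((f ^^ m) x) y < \<epsilon> / 2"
    using y \<epsilon> unfolding orbit_closure_iff by (metis commute half_gt_zero in_mball)
  obtain \<delta> where \<delta>: "\<delta> > 0"
    "\<And>u v i. u \<in> X \<Longrightarrow> v \<in> X \<Longrightarrow> d u v < \<delta> \<Longrightarrow> i \<le> m \<Longrightarrow> d ((f ^^ i) u) ((f ^^ i) v) < \<epsilon> / 2"
    using iterates_equicontinuous[of "\<epsilon> / 2"] \<epsilon> by (metis half_gt_zero)
  obtain N where N: "\<forall>i\<ge>1. {i..i + N} \<inter> hitting_times f x (mball x (\<delta> / 2)) \<noteq> {}"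
    using ur \<delta>(1) unfolding uniformly_recurrent_def syndetic_def by (meson half_gt_zero)
  have "{t..t + (N + m)} \<inter> hitting_times f y (mball y \<epsilon>) \<noteq> {}" if t: "t \<ge> 1" for t
  proof -
    obtain \<eta> where \<eta>: "\<eta> > 0"
      "\<And>u v i. u \<in> X \<Longrightarrow> v \<in> X \<Longrightarrow> d u v < \<eta> \<Longrightarrow> i \<le> t + N \<Longrightarrow>
        d ((f ^^ i) u) ((f ^^ i) v) < \<delta> / 2"
      using iterates_equicontinuous[of "\<delta> / 2" "t + N"] \<delta>(1) by (metis half_gt_zero)
    obtain n where n: "n \<ge> 1" "d ((f ^^ n) x) y < \<eta>"
      using y \<eta>(1) unfolding orbit_closure_iff by (metis commute in_mball)
    \<comment> \<open>Follow \<open>f\<^sup>n x\<close>, which stays close to the orbit of \<open>y\<close> up to time \<open>t + N\<close>.\<close>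
    have "n + t \<ge> 1" using n by simp
    then obtain s where s: "s \<in> {n + t..n + t + N}" "(f ^^ s) x \<in> mball x (\<delta> / 2)"
      using N unfolding hitting_times_def by blast
    define i where "i = s - n"
    have i: "i \<in> {t..t + N}" "s = i + n" using s(1) by (auto simp: i_def)
    have "d ((f ^^ i) ((f ^^ n) x)) ((f ^^ i) y) < \<delta> / 2"
      using \<eta>(2)[OF iterate_in[OF x] yX n(2)] i by simp
    moreover have "d x ((f ^^ i) ((f ^^ n) x)) < \<delta> / 2"
      using s(2) by (simp add: i(2) funpow_add)
    ultimately have "d x ((f ^^ i) y) < \<delta>"
      using triangle[OF x iterate_in[OF iterate_in[OF x], of i n] iterate_in[OF yX, of i]]
      by linarith
    then have "d ((f ^^ m) x) ((f ^^ m) ((f ^^ i) y)) < \<epsilon> / 2"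
      using \<delta>(2)[OF x iterate_in[OF yX]] by blast
    then have "d y ((f ^^ (m + i)) y) < \<epsilon>"
      using m(2) triangle[OF yX iterate_in[OF x, of m] iterate_in[OF yX, of "m + i"]]
      by (simp add: funpow_add commute)
    then have "m + i \<in> hitting_times f y (mball y \<epsilon>)"
      using yX m(1) iterate_in[OF yX] by (simp add: hitting_times_def)
    moreover have "m + i \<in> {t..t + (N + m)}" using i by auto
    ultimately show ?thesis by blast
  qed
  moreover have "1 \<le> N + m" using m by simp
  ultimately show "syndetic (hitting_times f y (mball y \<epsilon>))"
    unfolding syndetic_def by (auto simp: hitting_times_def)
qed

end

section \<open>Product recurrent points are distal\<close>

text \<open>
  The bridge between combinatorics and dynamics: a self-replicating subset of \<open>A\<close>, read as a point
  of the shift, is a test point that turns product recurrence into a common element.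
\<close>

lemma ps_product_recurrent_hits:
  assumes PR: "ps_product_recurrent X d f x"
    and A: "\<And>B. finite B \<Longrightarrow> B \<subseteq> A \<Longrightarrow> piecewise_syndetic (translation_times A B)"
    and U: "openin (Metric_space.mtopology X d) U" "x \<in> U"
  shows "hitting_times f x U \<inter> A \<noteq> {}"
proof -
  obtain C where C: "C \<subseteq> A"
    "\<And>k. piecewise_syndetic {n. n \<ge> 1 \<and> (\<forall>t\<le>k. n + t \<in> C \<longleftrightarrow> t \<in> insert 0 C)}"
    using self_replicating_subset_exists[OF A] by blast
  have "hitting_times f x U \<inter> C \<noteq> {}"
    by (rule recurrent_pair_meets[OF PR indicator_ps_recurrent[OF C(2)] U])
  then show ?thesis using C(1) by blast
qed

context dynamical_system
begin

text \<open>
  If the return times to some ball had unbounded gaps, the times outside the ball would form a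
  thick set, and thick sets contain translates of each of their finite subsets along thick sets.
  So the return times would have to meet their own complement.
\<close>

lemma ps_product_recurrent_imp_uniformly_recurrent:
  assumes "x \<in> X" and PR: "ps_product_recurrent X d f x"
  shows "uniformly_recurrent x"
proof (rule ccontr)
  assume "\<not> uniformly_recurrent x"
  then obtain \<epsilon> where \<epsilon>: "\<epsilon> > 0" "\<not> syndetic (hitting_times f x (mball x \<epsilon>))"
    unfolding uniformly_recurrent_def by blast
  let ?A = "{1..} - hitting_times f x (mball x \<epsilon>)"
  have "thick ?A" by (rule thick_compl_not_syndetic[OF _ \<epsilon>(2)]) (auto simp: hitting_times_def)
  then have "piecewise_syndetic (translation_times ?A B)" if "finite B" for B
    using thick_translation_times thick_imp_piecewise_syndetic that by blast
  then have "hitting_times f x (mball x \<epsilon>) \<inter> ?A \<noteq> {}"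
    by (intro ps_product_recurrent_hits[OF PR]) (use assms(1) \<epsilon>(1) in auto)
  then show False by blast
qed

text \<open>
  Suppose that \<open>y\<close> visits its ball at the times in \<open>B\<close>. Then so does every point close enough to
  \<open>y\<close>. Since \<open>y\<close> returns close to itself along a syndetic set, and \<open>x\<close> is close to \<open>y\<close> along a thick
  set, both \<open>x\<close> and \<open>y\<close> are that close to \<open>y\<close> at piecewise syndetically many times \<open>n\<close>. Tracking
  \<open>y\<close> along with \<open>x\<close> makes the argument apply again to any larger finite set of joint visiting
  times; the visiting times of \<open>x\<close> alone would not allow this.
\<close>

lemma joint_hitting_times_translation:
  assumes x: "x \<in> X" and y: "y \<in> X" and ur: "uniformly_recurrent y"
    and prox: "proximal d f x y" and r: "r > 0"
    and B: "finite B" "B \<subseteq> hitting_times f x (mball y r) \<inter> hitting_times f y (mball y r)"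
  shows "piecewise_syndetic
    (translation_times (hitting_times f x (mball y r) \<inter> hitting_times f y (mball y r)) B)"
    (is "piecewise_syndetic (translation_times ?A B)")
proof -
  let ?B = "insert 0 B"
  have fB: "d y ((f ^^ b) y) < r" if "b \<in> ?B" for b
    using that B(2) r y by (auto simp: hitting_times_def)
  \<comment> \<open>A common margin by which the finitely many points \<open>f\<^sup>b y\<close> stay inside the ball.\<close>
  define \<epsilon> where "\<epsilon> = Min ((\<lambda>b. r - d y ((f ^^ b) y)) ` ?B)"
  have "0 < a" if "a \<in> (\<lambda>b. r - d y ((f ^^ b) y)) ` ?B" for a
  proof -
    obtain b where "b \<in> ?B" "a = r - d y ((f ^^ b) y)" using \<open>a \<in> _\<close> by blast
    then show ?thesis using fB[of b] by simp
  qed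
  then have \<epsilon>: "\<epsilon> > 0" unfolding \<epsilon>_def using B(1) by (subst Min_gr_iff) auto
  have margin: "\<epsilon> \<le> r - d y ((f ^^ b) y)" if "b \<in> ?B" for b
    unfolding \<epsilon>_def using B(1) that by (intro Min_le) auto
  obtain K where K: "?B \<subseteq> {..K}" using B(1) finite_nat_iff_bounded_le by blast
  obtain \<delta> where \<delta>: "\<delta> > 0"
    "\<And>u v i. u \<in> X \<Longrightarrow> v \<in> X \<Longrightarrow> d u v < \<delta> \<Longrightarrow> i \<le> K \<Longrightarrow> d ((f ^^ i) u) ((f ^^ i) v) < \<epsilon>"
    using iterates_equicontinuous[OF \<epsilon>] by metis
  have near: "(f ^^ b) w \<in> mball y r" if w: "w \<in> X" "d y w < \<delta>" and b: "b \<in> ?B" for w b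
  proof -
    have "d ((f ^^ b) y) ((f ^^ b) w) < \<epsilon>" using \<delta>(2)[OF y w] K b by blast
    then show ?thesis
      using triangle[OF y iterate_in[OF y, of b] iterate_in[OF w(1), of b]] margin[OF b]
        y iterate_in[OF w(1)] by simp
  qed
  define T where "T = {n. n \<ge> 1 \<and> d ((f ^^ n) x) ((f ^^ n) y) < \<delta> / 2}"
  define S where "S = hitting_times f y (mball y (\<delta> / 2))"
  have "thick T" unfolding T_def by (rule proximal_thick[OF x y prox]) (use \<delta>(1) in simp)
  moreover have "syndetic S"
    using ur \<delta>(1) unfolding S_def uniformly_recurrent_def by simp
  ultimately have "piecewise_syndetic (T \<inter> S)" unfolding piecewise_syndetic_def by blast
  moreover have "T \<inter> S \<subseteq> translation_times ?A B"
  proof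
    fix n assume n: "n \<in> T \<inter> S"
    then have n1: "n \<ge> 1" and nxy: "d ((f ^^ n) x) ((f ^^ n) y) < \<delta> / 2"
      and ny: "d y ((f ^^ n) y) < \<delta> / 2"
      by (auto simp: T_def S_def hitting_times_def)
    have "d y ((f ^^ n) x) < \<delta>"
      using triangle[OF y iterate_in[OF y, of n] iterate_in[OF x, of n]] nxy ny
      by (simp add: commute)
    moreover have "d y ((f ^^ n) y) < \<delta>" using ny \<delta>(1) by simp
    ultimately have "(f ^^ b) ((f ^^ n) x) \<in> mball y r" "(f ^^ b) ((f ^^ n) y) \<in> mball y r"
      if "b \<in> ?B" for b
      using near[OF iterate_in[OF x] _ that] near[OF iterate_in[OF y] _ that] by blast+
    then have "n + b \<in> ?A" if "b \<in> ?B" for b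
      using that n1 by (auto simp: hitting_times_def add.commute[of n] funpow_add)
    then show "n \<in> translation_times ?A B" by (force simp: translation_times_def)
  qed
  moreover have "translation_times ?A B \<subseteq> {1..}"
    by (auto simp: translation_times_def hitting_times_def)
  ultimately show ?thesis by (rule piecewise_syndetic_mono)
qed

end

theorem theorem3:
  fixes X :: "'a set" and d :: "'a \<Rightarrow> 'a \<Rightarrow> real" and f :: "'a \<Rightarrow> 'a" and x :: 'a
  assumes "dynamical_system X d f"
    and "x \<in> X"
    and "ps_product_recurrent X d f x"
  shows "distal_point X d f x"
proof -
  interpret dynamical_system X d f by fact
  note x = \<open>x \<in> X\<close>
  have "\<not> proximal d f x y" if y: "y \<in> orbit_closure X d f x" and "y \<noteq> x" for y
  proof
    assume prox: "proximal d f x y"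
    have yX: "y \<in> X" using y by (simp add: orbit_closure_iff)
    have ur: "uniformly_recurrent y"
      using uniformly_recurrent_orbit_closure[OF x _ y]
        ps_product_recurrent_imp_uniformly_recurrent[OF x assms(3)] by blast
    define r where "r = d x y / 2"
    have r: "r > 0" using \<open>y \<noteq> x\<close> x yX by (simp add: r_def)
    let ?A = "hitting_times f x (mball y r) \<inter> hitting_times f y (mball y r)"
    have "hitting_times f x (mball x r) \<inter> ?A \<noteq> {}"
      by (rule ps_product_recurrent_hits[OF assms(3)
            joint_hitting_times_translation[OF x yX ur prox r]]) (use x r in auto)
    then obtain n where "d x ((f ^^ n) x) < r" "d y ((f ^^ n) x) < r"
      by (auto simp: hitting_times_def)
    then show False
      using triangle[OF x iterate_in[OF x, of n] yX] by (simp add: r_def commute)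
  qed
  then show ?thesis using x by (simp add: distal_point_def)
qed

end
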